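(* Let $f\colon I\to I$ be a tent map of slope $\lambda\in(\sqrt2,2)$ on its dynamical interval $I=[a,b]$, with turning point $c$ and kneading sequence $\kappa=\kappa(f)$. Let $s\in\{0,1\}^{\mathbb N}$. Then $s\in j_f$ (i.e. $s$ is an itinerary of some $x\in I$) if and only if the following three conditions hold: (a) $\sigma^r(s)\preceq\kappa$ for all $r\ge0$; (b) $\sigma(\kappa)\preceq s$; and (c) if $c$ is periodic and $\sigma^r(s)=\kappa$ for some $r>0$, then $s_{r-1}=\varepsilon(f)$.
   Context: **Tent maps.** $I=[a,b]$ is a compact interval and $f\colon I\to I$ is a (continuous) tent map of slope $\lambda\in(\sqrt2,2)$: there is $c\in(a,b)$ such that $f$ has constant slope $\lambda$ on $[a,c]$ and constant slope $-\lambda$ on $[c,b]$. $I$ is the dynamical interval (core) of $f$: $f(c)=b$ and $f(b)=a$. **Sequences and unimodal order.** $\mathbb N=\{0,1,2,\dots\}$, and $\sigma\colon\{0,1\}^{\mathbb N}\to\{0,1\}^{\mathbb N}$ is the shift map, $\sigma(s)_i=s_{i+1}$. A word is even (odd) if it contains an even (odd) number of $1$s. For distinct $s,t\in\{0,1\}^{\mathbb N}$, $s\prec t$ iff the word $s_0\ldots s_r$ is even, where $r\ge0$ is least with $s_r\ne t_r$. $\preceq$ is the corresponding non-strict order. **Itineraries and kneading sequence.** If $c$ is a periodic point of $f$, of period $n$, let $\varepsilon(f)=0$ (resp. $1$) if an even (resp. odd) number of the points $f^r(c)$, $1\le r<n$, lie in $(c,b]$; the (unique) itinerary $j(x)\in\{0,1\}^{\mathbb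 N}$ of $x\in I$ has $j(x)_r=0$, $1$, or $\varepsilon(f)$ according as $f^r(x)\in[a,c)$, $f^r(x)\in(c,b]$, or $f^r(x)=c$; and $\kappa(f)=j(b)$. If $c$ is not periodic, $s\in\{0,1\}^{\mathbb N}$ is an itinerary of $x\in I$ if $f^r(x)\in[a,c]$ whenever $s_r=0$ and $f^r(x)\in[c,b]$ whenever $s_r=1$ (so $x$ has two itineraries if $c$ is in its forward orbit, and one otherwise); and $\kappa(f)$ is the (unique) itinerary of $b$. $j_f\subset\{0,1\}^{\mathbb N}$ is the set of all itineraries of points of $I$. *)

theory Defs
  imports Complex_Main "HOL-Library.Z2" "HOL-Combinatorics.Cycles"
begin

text \<open>
  The map is a total function \<^term>\<open>f :: real \<Rightarrow> real\<close>; only its values on the interval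
  \<open>{a..b}\<close> matter, since that interval is mapped into itself.
\<close>

locale tent_map =
  fixes f :: "real \<Rightarrow> real" and a b c slope :: real
  assumes turning_point: "c \<in> {a<..<b}"
    and maps_to: "f ` {a..b} \<subseteq> {a..b}"
    and continuous: "continuous_on {a..b} f"
    and slope_left: "\<And>x y. x \<in> {a..c} \<Longrightarrow> y \<in> {a..c} \<Longrightarrow> f y - f x = slope * (y - x)"
    and slope_right: "\<And>x y. x \<in> {c..b} \<Longrightarrow> y \<in> {c..b} \<Longrightarrow> f y - f x = - slope * (y - x)"
    and turning_value: "f c = b"
    and right_endpoint_value: "f b = a"

definition periodic_point :: "('a \<Rightarrow> 'a) \<Rightarrow> 'a \<Rightarrow> bool" where
  "periodic_point f x \<longleftrightarrow> (\<exists>n>0. (f ^^ n) x = x)"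

definition shift :: "(nat \<Rightarrow> 'a) \<Rightarrow> (nat \<Rightarrow> 'a)" where
  "shift s = (\<lambda>i. s (Suc i))"

definition even_word :: "bit list \<Rightarrow> bool" where
  "even_word w \<longleftrightarrow> even (count_list w 1)"

definition unimodal_less :: "(nat \<Rightarrow> bit) \<Rightarrow> (nat \<Rightarrow> bit) \<Rightarrow> bool"  (infix "\<prec>" 50) where
  "s \<prec> t \<longleftrightarrow> s \<noteq> t \<and> even_word (map s [0..<Suc (LEAST r. s r \<noteq> t r)])"

definition unimodal_le :: "(nat \<Rightarrow> bit) \<Rightarrow> (nat \<Rightarrow> bit) \<Rightarrow> bool"  (infix "\<preceq>" 50) where
  "s \<preceq> t \<longleftrightarrow> s \<prec> t \<or> s = t"

text \<open>
  Meaningful only when \<open>c\<close> is a periodic point of \<open>f\<close>, in which case \<^term>\<open>least_power f c\<close>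
  is its period and the points \<open>(f ^^ r) c\<close> counted here are pairwise distinct.
\<close>

definition epsilon :: "(real \<Rightarrow> real) \<Rightarrow> real \<Rightarrow> real \<Rightarrow> bit" where
  "epsilon f b c =
     (if even (card {r \<in> {1..<least_power f c}. (f ^^ r) c \<in> {c<..b}}) then 0 else 1)"

definition is_itinerary ::
    "(real \<Rightarrow> real) \<Rightarrow> real \<Rightarrow> real \<Rightarrow> real \<Rightarrow> real \<Rightarrow> (nat \<Rightarrow> bit) \<Rightarrow> bool" where
  "is_itinerary f a b c x s \<longleftrightarrow>
     (if periodic_point f c
      then \<forall>r. ((f ^^ r) x \<in> {a..<c} \<longrightarrow> s r = 0) \<and>
               ((f ^^ r) x \<in> {c<..b} \<longrightarrow> s r = 1) \<and>
               ((f ^^ r) x = c \<longrightarrow> s r = epsilon f b c)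
      else \<forall>r. (s r = 0 \<longrightarrow> (f ^^ r) x \<in> {a..c}) \<and>
               (s r = 1 \<longrightarrow> (f ^^ r) x \<in> {c..b}))"

definition itineraries :: "(real \<Rightarrow> real) \<Rightarrow> real \<Rightarrow> real \<Rightarrow> real \<Rightarrow> (nat \<Rightarrow> bit) set" where
  "itineraries f a b c = {s. \<exists>x\<in>{a..b}. is_itinerary f a b c x s}"

text \<open>The description is proper for tent maps: see \<open>ex1_itinerary_right_endpoint\<close> below.\<close>

definition kneading_sequence :: "(real \<Rightarrow> real) \<Rightarrow> real \<Rightarrow> real \<Rightarrow> real \<Rightarrow> (nat \<Rightarrow> bit)" where
  "kneading_sequence f a b c = (THE s. is_itinerary f a b c b s)"

context tent_map
begin

lemma funpow_in_interval: "x \<in> {a..b} \<Longrightarrow> (f ^^ r) x \<in> {a..b}"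
proof (induction r)
  case (Suc r)
  then show ?case using maps_to by (simp add: image_subset_iff)
qed simp

lemma ex1_itinerary_right_endpoint: "\<exists>!s. is_itinerary f a b c b s"
proof -
  have b: "b \<in> {a..b}" using turning_point by auto
  have iv: "(f ^^ r) b \<in> {a..b}" for r using funpow_in_interval[OF b] .
  let ?e = "\<lambda>r. (f ^^ r) b"
  let ?s = "\<lambda>r. if ?e r < c then 0 else if c < ?e r then 1 else epsilon f b c"
  have nonper: "?e r \<noteq> c" if "\<not> periodic_point f c" for r
  proof
    assume "?e r = c"
    then have "(f ^^ Suc r) c = c"
      using turning_value by (simp add: funpow_swap1)
    with that show False unfolding periodic_point_def by blast
  qed
  show ?thesis
  proof (rule ex1I[of _ ?s])
    show "is_itinerary f a b c b ?s"
      using iv nonper by (fastforce simp: is_itinerary_def)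
  next
    fix s assume s: "is_itinerary f a b c b s"
    show "s = ?s"
    proof
      fix r
      have bit: "s r = 0 \<or> s r = 1" by (cases "s r") auto
      show "s r = ?s r"
        using s iv[of r] nonper[of r] bit unfolding is_itinerary_def
        by (cases "periodic_point f c"; cases "?e r" c rule: linorder_cases) force+
    qed
  qed
qed

end

end

theory Submission
  imports Defs
begin

text \<open>
  The sign of a word is \<open>1\<close> if it is even and \<open>-1\<close> if it is odd. If \<open>s\<close> is an itinerary of \<open>x\<close>,
  the distance of \<open>x\<close> from the right endpoint is
  \<open>b - x = (b - c) S(s)\<close>, where \<open>S(s) = (\<Sum>i. sign(s\<^sub>0\<dots>s\<^bsub>i-1\<^esub>) \<mu>^i)\<close> and \<open>\<mu> = 1 / slope\<close>. Thus the
  theorem becomes a statement about the series \<open>S\<close> (\<open>sign_series\<close>), and everything about the order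
  comes from one identity (\<open>sign_series_difference\<close>): if \<open>s \<prec> t\<close> first differ at position \<open>k\<close>, then
  \<open>S(s) - S(t) = \<mu>^(k+1) (S(\<sigma>^(k+1) s) + S(\<sigma>^(k+1) t))\<close>.

  On sequences all of whose shifts have \<open>S \<ge> 0\<close>, in particular on itineraries of points of the
  interval, the identity says that \<open>S\<close> is antitone, so that a point is a monotone function of its
  itinerary (\<open>itinerary_mono\<close>). Conditions (a) and (b) for an itinerary follow because the
  endpoints \<open>b\<close> and \<open>a\<close> have only the itineraries \<open>\<kappa>\<close> and \<open>\<sigma>(\<kappa>)\<close>; condition (c) follows because
  \<open>S\<close> determines the point and only \<open>c\<close> is mapped to \<open>b\<close>.

  For the converse, the candidates for the orbit are the points \<open>b - (b - c) S(\<sigma>^r s)\<close>. That they do not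
  exceed \<open>b\<close> is \<open>sign_series_nonneg\<close>: if \<open>m\<close> is the infimum of the values \<open>S(\<sigma>^r s)\<close> and \<open>m < 0\<close>,
  then \<open>S(\<kappa>) = 0\<close>, \<open>S(\<sigma>^j \<kappa>) \<ge> 0\<close> and the identity for \<open>\<sigma>^r s \<preceq> \<kappa>\<close> give \<open>S(\<sigma>^r s) \<ge> \<mu> m\<close> for
  every \<open>r\<close>, hence \<open>m \<ge> \<mu> m\<close>, which is absurd. Condition (b) makes the first point at least \<open>a\<close>, and
  invariance of the interval does the same for the others. This yields a point
  that follows \<open>s\<close> up to the choice of symbol at visits to \<open>c\<close>. If \<open>c\<close> is periodic, that choice is
  the right one: after a visit to \<open>c\<close> the remaining sequence follows the orbit of \<open>b\<close> in the same loose
  sense, and the parity built into \<open>\<epsilon>(f)\<close> makes \<open>\<kappa>\<close> the only such sequence that is \<open>\<preceq> \<kappa>\<close>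
  (\<open>weak_itinerary_right_endpoint_le_kneading\<close>); then (c) applies.
\<close>

section \<open>Sign series of binary sequences\<close>

definition branch_sign :: "bit \<Rightarrow> real" where
  "branch_sign e = (if e = 0 then 1 else -1)"

definition word_sign :: "(nat \<Rightarrow> bit) \<Rightarrow> nat \<Rightarrow> real" where
  "word_sign s n = (\<Prod>i<n. branch_sign (s i))"

definition sign_series :: "real \<Rightarrow> (nat \<Rightarrow> bit) \<Rightarrow> real" where
  "sign_series \<mu> s = (\<Sum>i. word_sign s i * \<mu> ^ i)"

lemma branch_sign_simps [simp]: "branch_sign 0 = 1" "branch_sign 1 = -1"
  by (simp_all add: branch_sign_def)

lemma branch_sign_neq: "x \<noteq> y \<Longrightarrow> branch_sign x = - branch_sign y"
  by (cases x; cases y) simp_all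

lemma branch_sign_cases: "branch_sign e = 1 \<or> branch_sign e = -1"
  by (simp add: branch_sign_def)

lemma word_sign_0 [simp]: "word_sign s 0 = 1"
  by (simp add: word_sign_def)

lemma word_sign_Suc: "word_sign s (Suc n) = word_sign s n * branch_sign (s n)"
  by (simp add: word_sign_def)

lemma word_sign_cong: "(\<And>i. i < n \<Longrightarrow> s i = t i) \<Longrightarrow> word_sign s n = word_sign t n"
  by (simp add: word_sign_def)

lemma word_sign_cases: "word_sign s n = 1 \<or> word_sign s n = -1"
proof (induction n)
  case (Suc n)
  then show ?case using branch_sign_cases[of "s n"] by (auto simp: word_sign_Suc)
qed simp

lemma abs_word_sign [simp]: "\<bar>word_sign s n\<bar> = 1"
  using word_sign_cases[of s n] by auto

lemma funpow_shift: "(shift ^^ n) s = (\<lambda>i. s (i + n))"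
  by (induction n) (simp_all add: shift_def fun_eq_iff)

lemma word_sign_add: "word_sign s (n + m) = word_sign s n * word_sign ((shift ^^ n) s) m"
  by (induction m) (simp_all add: word_sign_Suc funpow_shift add.commute)

lemma word_sign_first_difference:
  assumes "\<And>i. i < k \<Longrightarrow> s i = t i" and "s k \<noteq> t k"
  shows "word_sign t (Suc k) = - word_sign s (Suc k)"
  using word_sign_cong[of k s t] branch_sign_neq[OF assms(2)] assms(1) by (simp add: word_sign_Suc)

lemma even_word_iff_word_sign: "even_word (map s [0..<n]) \<longleftrightarrow> word_sign s n = 1"
proof -
  have "word_sign s n = (-1) ^ count_list (map s [0..<n]) 1"
  proof (induction n)
    case (Suc n)
    then show ?case by (cases "s n") (simp_all add: word_sign_Suc)
  qed simp
  then show ?thesis by (simp add: even_word_def minus_one_power_iff)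
qed

lemma unimodal_less_iff:
  "s \<prec> t \<longleftrightarrow> (\<exists>k. (\<forall>i<k. s i = t i) \<and> s k \<noteq> t k \<and> word_sign s (Suc k) = 1)"
proof
  assume less: "s \<prec> t"
  let ?k = "LEAST r. s r \<noteq> t r"
  from less have "\<exists>r. s r \<noteq> t r" by (auto simp: unimodal_less_def)
  then have "s ?k \<noteq> t ?k" by (rule LeastI_ex)
  moreover have "\<forall>i<?k. s i = t i" using not_less_Least by blast
  moreover have "word_sign s (Suc ?k) = 1"
    using less unfolding unimodal_less_def even_word_iff_word_sign by blast
  ultimately show "\<exists>k. (\<forall>i<k. s i = t i) \<and> s k \<noteq> t k \<and> word_sign s (Suc k) = 1" by blast
next
  assume "\<exists>k. (\<forall>i<k. s i = t i) \<and> s k \<noteq> t k \<and> word_sign s (Suc k) = 1"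
  then obtain k where k: "\<forall>i<k. s i = t i" "s k \<noteq> t k" "word_sign s (Suc k) = 1" by blast
  have "(LEAST r. s r \<noteq> t r) = k"
    using k(1,2) by (intro Least_equality) (auto simp: not_less[symmetric])
  with k show "s \<prec> t"
    unfolding unimodal_less_def even_word_iff_word_sign by auto
qed

lemma unimodal_le_or_less: "s \<preceq> t \<or> t \<prec> s"
proof (cases "s = t")
  case False
  define k where "k = (LEAST r. s r \<noteq> t r)"
  have "\<exists>r. s r \<noteq> t r" using False by auto
  then have neq: "s k \<noteq> t k" unfolding k_def by (rule LeastI_ex)
  have eq: "\<forall>i<k. s i = t i" unfolding k_def using not_less_Least by blast
  have "word_sign t (Suc k) = - word_sign s (Suc k)"
    using word_sign_first_difference eq neq by blast
  then have "word_sign s (Suc k) = 1 \<or> word_sign t (Suc k) = 1"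
    using word_sign_cases[of s "Suc k"] by auto
  then show ?thesis
    unfolding unimodal_le_def unimodal_less_iff using eq neq by metis
qed (simp add: unimodal_le_def)

context
  fixes \<mu> :: real
  assumes \<mu>: "0 < \<mu>" "\<mu> < 1"
begin

lemma summable_sign_series: "summable (\<lambda>i. word_sign s i * \<mu> ^ i)"
  using \<mu> by (intro summable_comparison_test'[OF summable_geometric[of \<mu>], of 0])
    (auto simp: abs_mult)

lemma sign_series_lower_bound: "- 1 / (1 - \<mu>) \<le> sign_series \<mu> s"
proof -
  have "word_sign s i * \<mu> ^ i \<ge> - (\<mu> ^ i)" for i
    using \<mu> word_sign_cases[of s i] by auto
  then have "(\<Sum>i. - (\<mu> ^ i)) \<le> sign_series \<mu> s"
    unfolding sign_series_def using \<mu>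
    by (intro suminf_le summable_sign_series summable_minus summable_geometric) auto
  then show ?thesis
    using \<mu> by (simp add: suminf_minus summable_geometric suminf_geometric)
qed

lemma sign_series_split:
  "sign_series \<mu> s =
     (\<Sum>i<n. word_sign s i * \<mu> ^ i) + word_sign s n * \<mu> ^ n * sign_series \<mu> ((shift ^^ n) s)"
proof -
  have "sign_series \<mu> s =
      (\<Sum>i. word_sign s (i + n) * \<mu> ^ (i + n)) + (\<Sum>i<n. word_sign s i * \<mu> ^ i)"
    unfolding sign_series_def by (rule suminf_split_initial_segment[OF summable_sign_series])
  also have "(\<lambda>i. word_sign s (i + n) * \<mu> ^ (i + n)) =
      (\<lambda>i. word_sign s n * \<mu> ^ n * (word_sign ((shift ^^ n) s) i * \<mu> ^ i))"
    by (simp add: add.commute[of _ n] word_sign_add power_add mult_ac)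
  also have "suminf \<dots> = word_sign s n * \<mu> ^ n * sign_series \<mu> ((shift ^^ n) s)"
    unfolding sign_series_def by (rule suminf_mult[OF summable_sign_series])
  finally show ?thesis by simp
qed

lemma sign_series_step: "sign_series \<mu> s = 1 + branch_sign (s 0) * \<mu> * sign_series \<mu> (shift s)"
  using sign_series_split[of s 1] by (simp add: word_sign_def)

text \<open>
  The terms up to position \<open>n\<close>, the first difference, agree because their signs depend only on
  earlier symbols. The remaining tails carry opposite signs, and \<open>s \<prec> t\<close> says that the sign
  belonging to \<open>s\<close> is positive; this turns the difference of the tails into a sum.
\<close>

lemma sign_series_difference:
  assumes "s \<prec> t"
  obtains n where "sign_series \<mu> s - sign_series \<mu> t =
    \<mu> ^ Suc n * (sign_series \<mu> ((shift ^^ Suc n) s) + sign_series \<mu> ((shift ^^ Suc n) t))"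
    and "word_sign t (Suc n) = -1"
proof -
  from assms obtain k where
    k: "\<And>i. i < k \<Longrightarrow> s i = t i" "s k \<noteq> t k" "word_sign s (Suc k) = 1"
    unfolding unimodal_less_iff by blast
  have t: "word_sign t (Suc k) = -1"
    using word_sign_first_difference[of k s t] k by simp
  have "(\<Sum>i<Suc k. word_sign s i * \<mu> ^ i) = (\<Sum>i<Suc k. word_sign t i * \<mu> ^ i)"
    using k(1) by (intro sum.cong refl arg_cong2[where f = "(*)"] word_sign_cong) auto
  then have "sign_series \<mu> s - sign_series \<mu> t =
      \<mu> ^ Suc k * (sign_series \<mu> ((shift ^^ Suc k) s) + sign_series \<mu> ((shift ^^ Suc k) t))"
    using sign_series_split[of s "Suc k"] sign_series_split[of t "Suc k"]
    unfolding k(3) t by (simp add: algebra_simps)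
  with t show thesis by (rule that[rotated])
qed

lemma sign_series_antimono:
  assumes "s \<preceq> t"
    and "\<And>r. 0 \<le> sign_series \<mu> ((shift ^^ r) s)" and "\<And>r. 0 \<le> sign_series \<mu> ((shift ^^ r) t)"
  shows "sign_series \<mu> t \<le> sign_series \<mu> s"
proof (cases "s = t")
  case False
  with assms(1) have "s \<prec> t" by (simp add: unimodal_le_def)
  then obtain n where "sign_series \<mu> s - sign_series \<mu> t =
    \<mu> ^ Suc n * (sign_series \<mu> ((shift ^^ Suc n) s) + sign_series \<mu> ((shift ^^ Suc n) t))"
    by (rule sign_series_difference)
  also have "\<dots> \<ge> 0" using \<mu> assms(2,3) by (intro mult_nonneg_nonneg add_nonneg_nonneg) (auto simp del: funpow.simps)
  finally show ?thesis by simp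
qed simp

text \<open>
  A lower bound that improves itself: if \<open>\<sigma>^r s \<prec> \<kappa>\<close>, their difference identity bounds the value at
  \<open>\<sigma>^r s\<close> below by a positive power of \<open>\<mu>\<close> times the value at a later shift of \<open>s\<close>. A negative infimum
  over all shifts would therefore be at least \<open>\<mu>\<close> times itself.
\<close>

lemma sign_series_nonneg:
  assumes zero: "sign_series \<mu> \<kappa> = 0" and nonneg: "\<And>r. 0 \<le> sign_series \<mu> ((shift ^^ r) \<kappa>)"
    and adm: "\<And>r. (shift ^^ r) s \<preceq> \<kappa>"
  shows "0 \<le> sign_series \<mu> s"
proof -
  define m where "m = (INF r. sign_series \<mu> ((shift ^^ r) s))"
  have bdd: "bdd_below (range (\<lambda>r. sign_series \<mu> ((shift ^^ r) s)))"
    using sign_series_lower_bound by (intro bdd_belowI2)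
  have m: "m \<le> sign_series \<mu> ((shift ^^ r) s)" for r
    unfolding m_def by (rule cINF_lower[OF bdd]) simp
  have "0 \<le> m"
  proof (rule ccontr)
    assume "\<not> 0 \<le> m"
    then have neg: "m < 0" by simp
    \<comment> \<open>For negative \<open>m\<close> this bound is better than \<open>m\<close>, which contradicts the choice of \<open>m\<close>.\<close>
    have "\<mu> * m \<le> sign_series \<mu> ((shift ^^ r) s)" for r
    proof (cases "(shift ^^ r) s = \<kappa>")
      case True
      then show ?thesis using zero neg \<mu> by (simp add: mult_le_0_iff)
    next
      case False
      with adm[of r] have "(shift ^^ r) s \<prec> \<kappa>" by (simp add: unimodal_le_def)
      then obtain n where n: "sign_series \<mu> ((shift ^^ r) s) - sign_series \<mu> \<kappa> =
          \<mu> ^ Suc n * (sign_series \<mu> ((shift ^^ Suc n) ((shift ^^ r) s)) +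
            sign_series \<mu> ((shift ^^ Suc n) \<kappa>))"
        by (rule sign_series_difference)
      have "\<mu> ^ Suc n * (-m) \<le> \<mu> * (-m)"
        using \<mu> neg power_decreasing[of 1 "Suc n" \<mu>] by (intro mult_right_mono) auto
      then have "\<mu> * m \<le> \<mu> ^ Suc n * m" by simp
      also have "\<dots> \<le> \<mu> ^ Suc n * (sign_series \<mu> ((shift ^^ Suc n) ((shift ^^ r) s)) +
            sign_series \<mu> ((shift ^^ Suc n) \<kappa>))"
        using \<mu> m[of "Suc n + r"] nonneg[of "Suc n"]
        by (intro mult_left_mono) (auto simp: funpow_add)
      finally show ?thesis using n zero by simp
    qed
    then have "\<mu> * m \<le> m" unfolding m_def by (intro cINF_greatest) (auto simp: m_def)
    moreover have "m < \<mu> * m" using neg \<mu> by simp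
    ultimately show False by simp
  qed
  with m[of 0] show ?thesis by simp
qed

end

section \<open>Points and itineraries\<close>

text \<open>
  Both symbols are admitted at \<open>c\<close>, whether or not \<open>c\<close> is periodic. This notion suffices for computing
  the point from the sequence, and a point constructed from
  its series is known to satisfy it before the symbols at \<open>c\<close> are settled.
\<close>

definition weak_itinerary ::
    "(real \<Rightarrow> real) \<Rightarrow> real \<Rightarrow> real \<Rightarrow> real \<Rightarrow> real \<Rightarrow> (nat \<Rightarrow> bit) \<Rightarrow> bool" where
  "weak_itinerary f a b c x s \<longleftrightarrow>
     (\<forall>r. (s r = 0 \<longrightarrow> (f ^^ r) x \<in> {a..c}) \<and> (s r = 1 \<longrightarrow> (f ^^ r) x \<in> {c..b}))"

lemma is_itinerary_shift:
  assumes "is_itinerary f a b c x s"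
  shows "is_itinerary f a b c ((f ^^ r) x) ((shift ^^ r) s)"
proof -
  have "(f ^^ n) ((f ^^ r) x) = (f ^^ (n + r)) x" for n by (simp add: funpow_add)
  then show ?thesis
    using assms unfolding is_itinerary_def funpow_shift by (auto split: if_splits)
qed

lemma weak_itinerary_shift:
  assumes "weak_itinerary f a b c x s"
  shows "weak_itinerary f a b c ((f ^^ r) x) ((shift ^^ r) s)"
proof -
  have "(f ^^ n) ((f ^^ r) x) = (f ^^ (n + r)) x" for n by (simp add: funpow_add)
  then show ?thesis
    using assms unfolding weak_itinerary_def funpow_shift by simp
qed

text \<open>
  Expansion is what makes the inverse branches contract and hence the series converge.
\<close>

locale expanding_tent_map = tent_map +
  assumes slope_gt_1: "1 < slope"
begin

abbreviation \<kappa> where "\<kappa> \<equiv> kneading_sequence f a b c"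

text \<open>
  The distance from \<open>b\<close> of the point with the given itinerary, in units of \<open>b - c\<close>.
\<close>

abbreviation depth :: "(nat \<Rightarrow> bit) \<Rightarrow> real" where
  "depth s \<equiv> sign_series (1 / slope) s"

lemma contraction: "0 < 1 / slope" "1 / slope < 1"
  using slope_gt_1 by auto

lemma a_less_c: "a < c" and c_less_b: "c < b"
  using turning_point by auto

lemma itinerary_right_endpoint_iff: "is_itinerary f a b c b s \<longleftrightarrow> s = \<kappa>"
  using theI'[OF ex1_itinerary_right_endpoint] ex1_itinerary_right_endpoint
  unfolding kneading_sequence_def[symmetric] by blast

lemma image_eq_right_endpoint_iff:
  assumes "x \<in> {a..b}"
  shows "f x = b \<longleftrightarrow> x = c"
proof
  assume "f x = b"
  then have "slope * (x - c) = 0"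
    using assms slope_left[of x c] slope_right[of x c] turning_value turning_point
    by (cases "x \<le> c") (auto simp: algebra_simps)
  then show "x = c" using slope_gt_1 by simp
qed (simp add: turning_value)

lemma itinerary_imp_weak:
  assumes "x \<in> {a..b}" and "is_itinerary f a b c x s"
  shows "weak_itinerary f a b c x s"
proof (cases "periodic_point f c")
  case True
  have "(s r = 0 \<longrightarrow> (f ^^ r) x \<in> {a..c}) \<and> (s r = 1 \<longrightarrow> (f ^^ r) x \<in> {c..b})" for r
    using funpow_in_interval[OF assms(1), of r] assms(2) True
    unfolding is_itinerary_def by (cases "(f ^^ r) x" c rule: linorder_cases) force+
  then show ?thesis by (simp add: weak_itinerary_def)
next
  case False
  with assms(2) show ?thesis by (simp add: is_itinerary_def weak_itinerary_def)
qed

text \<open>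
  On each branch \<open>f\<close> is affine with \<open>f c = b\<close>, so the normalised distances \<open>v r\<close> of the orbit from \<open>b\<close>
  satisfy \<open>v r = 1 \<plusminus> v (r + 1) / slope\<close>, with the sign of the \<open>r\<close>-th symbol. Unrolling this recursion
  gives the partial sums of the series; the remainder vanishes since the \<open>v r\<close> are bounded.
\<close>

lemma weak_itinerary_imp_depth:
  assumes x: "x \<in> {a..b}" and s: "weak_itinerary f a b c x s"
  shows "b - x = (b - c) * depth s"
proof -
  define v where "v r = (b - (f ^^ r) x) / (b - c)" for r
  have step: "v r = 1 + branch_sign (s r) * (1 / slope) * v (Suc r)" for r
  proof (cases "s r")
    case zero
    then have "(f ^^ r) x \<in> {a..c}" using s by (simp add: weak_itinerary_def)
    then have "f ((f ^^ r) x) = b + slope * ((f ^^ r) x - c)"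
      using slope_left[of "(f ^^ r) x" c] turning_point turning_value by (auto simp: algebra_simps)
    then have "b - (f ^^ Suc r) x = - slope * ((f ^^ r) x - c)" by simp
    then have "v (Suc r) = - slope * ((f ^^ r) x - c) / (b - c)" by (simp only: v_def)
    then show ?thesis
      using zero c_less_b slope_gt_1 by (simp add: v_def divide_simps)
  next
    case one
    then have "(f ^^ r) x \<in> {c..b}" using s by (simp add: weak_itinerary_def)
    then have "f ((f ^^ r) x) = b - slope * ((f ^^ r) x - c)"
      using slope_right[of c "(f ^^ r) x"] turning_point turning_value by (auto simp: algebra_simps)
    then have "b - (f ^^ Suc r) x = slope * ((f ^^ r) x - c)" by simp
    then have "v (Suc r) = slope * ((f ^^ r) x - c) / (b - c)" by (simp only: v_def)
    then show ?thesis
      using one c_less_b slope_gt_1 by (simp add: v_def divide_simps)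
  qed
  have partial: "v 0 = (\<Sum>i<n. word_sign s i * (1 / slope) ^ i) + word_sign s n * (1 / slope) ^ n * v n" for n
  proof (induction n)
    case (Suc n)
    then show ?case
      by (subst (asm) step[of n]) (simp add: word_sign_Suc algebra_simps)
  qed simp
  have bound: "\<bar>v n\<bar> \<le> (b - a) / (b - c)" for n
    using funpow_in_interval[OF x, of n] c_less_b by (auto simp: v_def divide_right_mono)
  have small: "norm (word_sign s n * (1 / slope) ^ n * v n) \<le> norm ((1 / slope) ^ n) * ((b - a) / (b - c))" for n
    using mult_left_mono[OF bound[of n], of "(1 / slope) ^ n"] contraction
    by (simp add: abs_mult del: power_one_over)
  have geometric: "(\<lambda>n. (1 / slope) ^ n) \<longlonglongrightarrow> 0"
    using contraction by (intro LIMSEQ_power_zero) auto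
  have "(\<lambda>n. word_sign s n * (1 / slope) ^ n * v n) \<longlonglongrightarrow> 0"
    by (rule tendsto_0_le[OF geometric always_eventually]) (rule allI, rule small)
  then have "(\<lambda>n. v 0 - word_sign s n * (1 / slope) ^ n * v n) \<longlonglongrightarrow> v 0 - 0"
    by (intro tendsto_intros)
  moreover have "(\<lambda>n. v 0 - word_sign s n * (1 / slope) ^ n * v n) =
      (\<lambda>n. \<Sum>i<n. word_sign s i * (1 / slope) ^ i)"
    using partial by (auto simp: algebra_simps)
  ultimately have "(\<lambda>i. word_sign s i * (1 / slope) ^ i) sums v 0" by (simp add: sums_def)
  then have "depth s = v 0" unfolding sign_series_def by (simp add: sums_iff)
  then show ?thesis using c_less_b by (simp add: v_def)
qed

lemma depth_nonneg:
  assumes "x \<in> {a..b}" and "weak_itinerary f a b c x s"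
  shows "0 \<le> depth ((shift ^^ r) s)"
proof -
  have "b - (f ^^ r) x = (b - c) * depth ((shift ^^ r) s)"
    by (intro weak_itinerary_imp_depth funpow_in_interval weak_itinerary_shift assms)
  moreover have "(f ^^ r) x \<le> b" using funpow_in_interval[OF assms(1), of r] by simp
  ultimately have "0 \<le> (b - c) * depth ((shift ^^ r) s)" by simp
  then show ?thesis using c_less_b by (simp add: zero_le_mult_iff)
qed

lemma itinerary_mono:
  assumes "x \<in> {a..b}" "y \<in> {a..b}" and "weak_itinerary f a b c x s" "weak_itinerary f a b c y t"
    and "s \<preceq> t"
  shows "x \<le> y"
proof -
  have "depth t \<le> depth s"
    using assms by (intro sign_series_antimono contraction depth_nonneg) 
  then have "(b - c) * depth t \<le> (b - c) * depth s" using c_less_b by (intro mult_left_mono) auto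
  then show ?thesis
    using weak_itinerary_imp_depth[OF assms(1,3)] weak_itinerary_imp_depth[OF assms(2,4)] by simp
qed

lemma endpoints: "a \<in> {a..b}" "b \<in> {a..b}"
  using turning_point by auto

lemma kneading_itinerary: "is_itinerary f a b c b \<kappa>"
  by (simp add: itinerary_right_endpoint_iff)

lemma kneading_weak_itinerary: "weak_itinerary f a b c b \<kappa>"
  by (rule itinerary_imp_weak[OF endpoints(2) kneading_itinerary])

lemma shift_kneading_weak_itinerary: "weak_itinerary f a b c a (shift \<kappa>)"
  using weak_itinerary_shift[OF kneading_weak_itinerary, of 1] by (simp add: right_endpoint_value)

text \<open>
  Prefixing an itinerary of \<open>a = f b\<close> with \<open>1\<close> gives an itinerary of \<open>b\<close>, so uniqueness is inherited
  from \<open>b\<close>.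
\<close>

lemma itinerary_left_endpoint:
  assumes "is_itinerary f a b c a s"
  shows "s = shift \<kappa>"
proof -
  define t where "t = case_nat 1 s"
  have orbit: "(f ^^ Suc r) b = (f ^^ r) a" for r
    by (simp add: funpow_swap1 right_endpoint_value)
  have zero: "(f ^^ 0) b = b" "t 0 = 1" and Suc: "t (Suc r) = s r" for r
    by (simp_all add: t_def)
  have all: "(\<forall>r. P r) \<longleftrightarrow> P 0 \<and> (\<forall>r. P (Suc r))" for P :: "nat \<Rightarrow> bool"
    by (metis nat.exhaust)
  have "is_itinerary f a b c b t"
    using assms c_less_b a_less_c unfolding is_itinerary_def
    by (subst (1 2) all) (auto simp: zero Suc orbit simp del: funpow.simps)
  then have "t = \<kappa>" by (simp add: itinerary_right_endpoint_iff)
  then show ?thesis using Suc by (auto simp: shift_def)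
qed


section \<open>Parity of the kneading sequence of a periodic turning point\<close>

text \<open>
  The purpose of \<open>\<epsilon>(f)\<close>: the first \<open>n - 1\<close> symbols of \<open>\<kappa>\<close>, for \<open>n\<close> the period of \<open>c\<close>, record the
  points \<open>f c, \<dots>, f^(n-1) c\<close>, and \<open>\<epsilon>(f)\<close> is the symbol that completes them to an even word. Every return
  of \<open>b\<close> to itself runs through a whole number of copies of this word.
\<close>

lemma kneading_word_even:
  assumes per: "periodic_point f c" and "(f ^^ m) b = b"
  shows "word_sign \<kappa> m = 1"
proof -
  define n where "n = least_power f c"
  have orbit: "(f ^^ Suc r) c = (f ^^ r) b" for r
    by (simp add: funpow_swap1 turning_value)
  from per have n: "(f ^^ n) c = c" "0 < n"
    unfolding periodic_point_def n_def by (auto intro: least_powerI)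
  have least: "(f ^^ r) c \<noteq> c" if "0 < r" "r < n" for r
    using least_power_le[of r f c] that by (auto simp: n_def)
  have entry: "\<kappa> r = (if (f ^^ Suc r) c = c then epsilon f b c else if (f ^^ Suc r) c \<in> {c<..b} then 1 else 0)" for r
    using kneading_itinerary per funpow_in_interval[OF endpoints(2), of r]
    unfolding is_itinerary_def orbit by (auto simp: not_less order.order_iff_strict)
  have "branch_sign (\<kappa> r) = (if (f ^^ Suc r) c \<in> {c<..b} then -1 else 1)" if "Suc r < n" for r
    using least[of "Suc r"] that by (simp add: entry del: funpow.simps)
  then have "word_sign \<kappa> (n - 1) = (\<Prod>r<n-1. if (f ^^ Suc r) c \<in> {c<..b} then -1 else 1)"
    unfolding word_sign_def by (intro prod.cong) auto
  also have "\<dots> = (\<Prod>r\<in>{1..<n}. if (f ^^ r) c \<in> {c<..b} then -1 else 1)"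
    by (rule prod.reindex_bij_witness[of _ "\<lambda>r. r - 1" Suc]) auto
  also have "\<dots> = (-1) ^ card {r \<in> {1..<n}. (f ^^ r) c \<in> {c<..b}}"
    by (subst prod.inter_filter[symmetric]) (simp_all add: prod_constant)
  also have "\<dots> = branch_sign (epsilon f b c)"
    by (simp add: epsilon_def n_def)
  finally have "word_sign \<kappa> (Suc (n - 1)) = 1"
    using n branch_sign_cases[of "epsilon f b c"] unfolding word_sign_Suc entry[of "n - 1"] by auto
  then have block: "word_sign \<kappa> n = 1" using n(2) by simp
  have "(f ^^ n) b = b"
    using n(1) by (metis funpow_swap1 turning_value)
  then have "(shift ^^ n) \<kappa> = \<kappa>"
    using is_itinerary_shift[OF kneading_itinerary, of n] by (simp add: itinerary_right_endpoint_iff)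
  then have blocks: "word_sign \<kappa> (n * q) = 1" for q
    by (induction q) (simp_all add: word_sign_add block)
  have "n dvd m"
  proof (cases m)
    case (Suc k)
    then have "(f ^^ k) b = c"
      using assms(2) image_eq_right_endpoint_iff[OF funpow_in_interval[OF endpoints(2), of k]] by simp
    then have "(f ^^ m) c = c" using orbit Suc by simp
    then show ?thesis unfolding n_def by (rule least_power_minimal)
  qed simp
  with blocks show ?thesis by (auto elim: dvdE)
qed

text \<open>
  Two weak itineraries of \<open>b\<close> can part only at a visit to \<open>c\<close>, that is, just before a return to \<open>b\<close>. The word of
  \<open>\<kappa>\<close> up to that visit is even, so that of \<open>t \<noteq> \<kappa>\<close> is odd, which makes \<open>t\<close> larger than \<open>\<kappa>\<close>.
\<close>

lemma weak_itinerary_right_endpoint_le_kneading: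
  assumes "periodic_point f c" and t: "weak_itinerary f a b c b t" and "t \<preceq> \<kappa>"
  shows "t = \<kappa>"
proof (rule ccontr)
  assume "t \<noteq> \<kappa>"
  with assms(3) have "t \<prec> \<kappa>" by (simp add: unimodal_le_def)
  then obtain n where n: "depth t - depth \<kappa> =
      (1 / slope) ^ Suc n * (depth ((shift ^^ Suc n) t) + depth ((shift ^^ Suc n) \<kappa>))"
    and odd: "word_sign \<kappa> (Suc n) = -1"
    by (rule sign_series_difference[OF contraction])
  have "depth t = 0" "depth \<kappa> = 0"
    using weak_itinerary_imp_depth[OF endpoints(2)] t kneading_weak_itinerary c_less_b by force+
  \<comment> \<open>Two nonnegative depths with sum zero: the orbit of \<open>b\<close> is at \<open>b\<close> after the first difference.\<close>
  with n have "depth ((shift ^^ Suc n) t) + depth ((shift ^^ Suc n) \<kappa>) = 0"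
    using contraction by simp
  then have "depth ((shift ^^ Suc n) \<kappa>) = 0"
    using depth_nonneg[OF endpoints(2) t, of "Suc n"]
      depth_nonneg[OF endpoints(2) kneading_weak_itinerary, of "Suc n"] by simp
  moreover have "b - (f ^^ Suc n) b = (b - c) * depth ((shift ^^ Suc n) \<kappa>)"
    by (intro weak_itinerary_imp_depth funpow_in_interval weak_itinerary_shift
        kneading_weak_itinerary endpoints)
  ultimately have "(f ^^ Suc n) b = b" by simp
  then have "word_sign \<kappa> (Suc n) = 1" by (rule kneading_word_even[OF assms(1)])
  with odd show False by simp
qed

section \<open>Realisation of admissible sequences\<close>

text \<open>
  The only possible orbit is read off from the depths of the shifts of \<open>s\<close>. That it stays at or below \<open>b\<close>
  makes each point lie on the side of \<open>c\<close> prescribed by \<open>s\<close>, so that \<open>f\<close> moves it to the next one.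
\<close>

lemma admissible_imp_weak_itinerary:
  assumes adm: "\<And>r. (shift ^^ r) s \<preceq> \<kappa>" and lower: "shift \<kappa> \<preceq> s"
  obtains x where "x \<in> {a..b}" and "weak_itinerary f a b c x s"
proof -
  define x where "x r = b - (b - c) * depth ((shift ^^ r) s)" for r
  have zero: "depth \<kappa> = 0"
    using weak_itinerary_imp_depth[OF endpoints(2) kneading_weak_itinerary] c_less_b by simp
  note kneading_nonneg = depth_nonneg[OF endpoints(2) kneading_weak_itinerary]
  have nonneg: "0 \<le> depth ((shift ^^ r) s)" for r
  proof (rule sign_series_nonneg[OF contraction zero kneading_nonneg])
    show "(shift ^^ q) ((shift ^^ r) s) \<preceq> \<kappa>" for q
      using adm[of "q + r"] by (simp add: funpow_add)
  qed
  have upper: "x r \<le> b" for r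
    using nonneg[of r] c_less_b by (simp add: x_def)
  have step: "depth ((shift ^^ r) s) =
      1 + branch_sign (s r) * (1 / slope) * depth ((shift ^^ Suc r) s)" for r
    using sign_series_step[OF contraction, of "(shift ^^ r) s"] by (simp add: funpow_shift shift_def)
  have distance: "c - x r = (b - c) * (branch_sign (s r) * (1 / slope) * depth ((shift ^^ Suc r) s))" for r
    unfolding x_def step[of r] by (simp add: algebra_simps)
  have scaled: "slope * (c - x r) = branch_sign (s r) * (b - x (Suc r))" for r
    unfolding distance using slope_gt_1 by (simp add: x_def)
  have move: "(b - c) * ((1 / slope) * depth ((shift ^^ Suc r) s)) \<ge> 0" for r
    using nonneg[of "Suc r"] contraction c_less_b by (intro mult_nonneg_nonneg) auto
  have side: "(s r = 0 \<longrightarrow> x r \<le> c) \<and> (s r = 1 \<longrightarrow> c \<le> x r)" for r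
    using distance[of r] move[of r] by auto
  have image: "f (x r) = x (Suc r)" if "x r \<in> {a..b}" for r
  proof (cases "s r")
    case zero
    then have "f (x r) = b - slope * (c - x r)"
      using that side[of r] slope_left[of "x r" c] turning_point turning_value by auto
    then show ?thesis
      using zero scaled[of r] by simp
  next
    case one
    then have "f (x r) = b + slope * (c - x r)"
      using that side[of r] slope_right[of c "x r"] turning_point turning_value
      by (auto simp: algebra_simps)
    then show ?thesis
      using one scaled[of r] by simp
  qed
  have start: "x 0 \<in> {a..b}"
  proof -
    have "depth s \<le> depth (shift \<kappa>)"
      using lower nonneg depth_nonneg[OF endpoints(1) shift_kneading_weak_itinerary]
      by (intro sign_series_antimono contraction)
    then have "(b - c) * depth s \<le> (b - c) * depth (shift \<kappa>)"
      using c_less_b by (intro mult_left_mono) auto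
    then show ?thesis
      using weak_itinerary_imp_depth[OF endpoints(1) shift_kneading_weak_itinerary] upper[of 0]
      by (simp add: x_def)
  qed
  have orbit: "(f ^^ r) (x 0) = x r \<and> x r \<in> {a..b}" for r
  proof (induction r)
    case 0
    show ?case using start by (simp only: funpow_0 simp_thms)
  next
    case (Suc r)
    then have "f (x r) \<in> {a..b}" using maps_to by blast
    with Suc image[of r] show ?case by simp
  qed
  have "weak_itinerary f a b c (x 0) s"
    unfolding weak_itinerary_def using orbit side by auto
  with start show thesis by (rule that)
qed

lemma itineraries_iff:
  "s \<in> itineraries f a b c \<longleftrightarrow>
      (\<forall>r. (shift ^^ r) s \<preceq> \<kappa>) \<and>
      shift \<kappa> \<preceq> s \<and>
      (periodic_point f c \<longrightarrow>
         (\<forall>r>0. (shift ^^ r) s = \<kappa> \<longrightarrow> s (r - 1) = epsilon f b c))"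
  (is "?itinerary \<longleftrightarrow> ?upper \<and> ?lower \<and> ?choice")
proof
  assume ?itinerary
  then obtain x where x: "x \<in> {a..b}" and s: "is_itinerary f a b c x s"
    by (auto simp: itineraries_def)
  note orbit = funpow_in_interval[OF x] and shifted = is_itinerary_shift[OF s]
  note weak = itinerary_imp_weak[OF orbit shifted]
  have ?upper
  proof (rule allI, rule ccontr)
    fix r assume not_le: "\<not> (shift ^^ r) s \<preceq> \<kappa>"
    then have "\<kappa> \<preceq> (shift ^^ r) s" using unimodal_le_or_less by (auto simp: unimodal_le_def)
    then have "b \<le> (f ^^ r) x"
      using itinerary_mono[OF endpoints(2) orbit kneading_weak_itinerary weak] by blast
    then have "(f ^^ r) x = b" using orbit[of r] by simp
    then have "(shift ^^ r) s = \<kappa>" using shifted[of r] by (simp add: itinerary_right_endpoint_iff)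
    with not_le show False by (simp add: unimodal_le_def)
  qed
  moreover have ?lower
  proof (rule ccontr)
    assume not_le: "\<not> shift \<kappa> \<preceq> s"
    then have "s \<preceq> shift \<kappa>" using unimodal_le_or_less by (auto simp: unimodal_le_def)
    then have "x \<le> a"
      using itinerary_mono[OF x endpoints(1) _ shift_kneading_weak_itinerary] weak[of 0] by simp
    then have "x = a" using x by simp
    then have "s = shift \<kappa>" using s itinerary_left_endpoint by simp
    with not_le show False by (simp add: unimodal_le_def)
  qed
  moreover have ?choice
  proof (intro impI allI)
    fix r :: nat assume per: "periodic_point f c" and "0 < r" and eq: "(shift ^^ r) s = \<kappa>"
    then obtain k where r: "r = Suc k" by (cases r) auto
    have "(b - c) * depth \<kappa> = 0"
      using weak_itinerary_imp_depth[OF endpoints(2) kneading_weak_itinerary] by simp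
    then have "(f ^^ r) x = b"
      using weak_itinerary_imp_depth[OF orbit weak, of r] unfolding eq by linarith
    then have "(f ^^ k) x = c" using r image_eq_right_endpoint_iff[OF orbit[of k]] by simp
    then show "s (r - 1) = epsilon f b c"
      using s per r by (simp add: is_itinerary_def)
  qed
  ultimately show "?upper \<and> ?lower \<and> ?choice" by blast
next
  assume conditions: "?upper \<and> ?lower \<and> ?choice"
  then obtain x where x: "x \<in> {a..b}" and s: "weak_itinerary f a b c x s"
    using admissible_imp_weak_itinerary by blast
  have "is_itinerary f a b c x s"
  proof (cases "periodic_point f c")
    case True
    have turning: "s r = epsilon f b c" if "(f ^^ r) x = c" for r
    proof -
      have "(f ^^ Suc r) x = b" using that turning_value by simp
      then have "weak_itinerary f a b c b ((shift ^^ Suc r) s)"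
        using weak_itinerary_shift[OF s, of "Suc r"] by simp
      then have "(shift ^^ Suc r) s = \<kappa>"
        using weak_itinerary_right_endpoint_le_kneading[OF True] conditions by blast
      then show ?thesis using conditions True by (metis diff_Suc_1 zero_less_Suc)
    qed
    have off: "((f ^^ r) x < c \<longrightarrow> s r = 0) \<and> (c < (f ^^ r) x \<longrightarrow> s r = 1)" for r
      using s unfolding weak_itinerary_def by (cases "s r") (force dest: spec[of _ r])+
    show ?thesis using True turning off by (simp add: is_itinerary_def)
  next
    case False
    with s show ?thesis by (simp add: is_itinerary_def weak_itinerary_def)
  qed
  with x show ?itinerary by (auto simp: itineraries_def)
qed

end

theorem lemma3:
  fixes f :: "real \<Rightarrow> real" and a b c slope :: real
    and s \<kappa> :: "nat \<Rightarrow> bit"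
  assumes "tent_map f a b c slope"
    and "sqrt 2 < slope" and "slope < 2"
    and "\<kappa> = kneading_sequence f a b c"
  shows "s \<in> itineraries f a b c \<longleftrightarrow>
      (\<forall>r. (shift ^^ r) s \<preceq> \<kappa>) \<and>
      shift \<kappa> \<preceq> s \<and>
      (periodic_point f c \<longrightarrow>
         (\<forall>r>0. (shift ^^ r) s = \<kappa> \<longrightarrow> s (r - 1) = epsilon f b c))"
proof -
  have "1 < sqrt 2" by simp
  with assms(2) have "1 < slope" by linarith
  with assms(1) interpret expanding_tent_map f a b c slope
    by (simp add: expanding_tent_map_def expanding_tent_map_axioms_def)
  show ?thesis unfolding assms(4) by (rule itineraries_iff)
qed

end
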